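(* Let $n\ge 3$, let $N=\{1,\dots,n\}$ be the set of buyers and $M=\{1,\dots,n\}$ the set of goods (equal number of buyers and goods). Suppose there are linear functions $w_i,f_i:\mathbb R\to\mathbb R$ $(i\in N)$, with every $w_i$ strictly increasing, such that: (1) each buyer's valuation of a nonempty set of goods equals the valuation of the highest-valued good in the set: $v_{i,S}=\max_{K\in S}v_{i,K}$; (2) $v_{i,K}(s_{1K},\dots,s_{nK})=w_i(s_{iK})+\sum_{j\ne i}f_j(s_{jK})$ for all $i\in N$, $K\in M$, $(s_{1K},\dots,s_{nK})\in\mathbb R^n$; (3) $w_i'>f_i'$ for all $i\in N$; (4) all valuations are nonnegative at the buyers' true signals; (5) for every $i\in N$ there are constants $c_i>1$ and $d_i\in\mathbb R$ with $w_i(x)=c_if_i(x)+d_i$ for all $x\in\mathbb R$; (6) each $f_i$ is injective with image $\mathbb R$. Then truthful bidding is a Nash equilibrium of Auction 3 (defined in the context), and Auction 3 is efficient.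
   Context: "Linear" means of the form $x\mapsto ax+b$. Buyer $i$ privately observes one signal $s_{iA}\in\mathbb R$ for each good $A$; $v_{i,A}$ (also written $v_{iA}$) is a function of $s_A=(s_{1A},\dots,s_{nA})\in\mathbb R^n$. Each buyer knows all valuation functions but only his or her own signals; the auction designer knows neither the signals nor the valuation functions. A buyer who receives a set $S$ of goods (with $v_{i,\emptyset}=0$) and pays $P$ has utility $v_{i,S}-P$, valuation evaluated at the true signals. The welfare of an allocation is the sum over buyers of their valuations of the sets they receive. $P_n$ is the set of permutations of $\{1,\dots,n\}$; $\sigma\in P_n$ represents the allocation in which buyer $i$ receives exactly good $\sigma(i)$. Auction 3: (Bidding) For every good $A$, every buyer $i$ submits a function $b_{iA}:\mathbb R^{n-1}\to\mathbb R$ of the form $b_{iA}(v_{-i})=x_{ii}^{(A)}+\sum_{j\ne i}x_{ij}^{(A)}v_j$ with real coefficients, where $v_{-i}=(v_j)_{j\neq i}$. (Allocation) The goods are allocated if and only if $x_{ij}^{(A)}\neq0$ for all $A\in M$ and all $i\ne j$, and for every $j\in N$ there is $c_j'>1$ such that $$\frac1{x_{ij}^{(A)}}\Big(1-\sum_{t\ne i,j}x_{it}^{(A)}\Big)=c_j'\quad\text{for all }A\in M\text{ and all }i\in N,\ i\ne j.$$ (Otherwise no good is allocated and nobody pays.) In this case, for each $A$ let $v_A^\circ=(v_{1A}^\circ,\dots,v_{nA}^\circ)$ be the (unique) fixed point: $b_{iA}\big((v_{jA}^\circ)_{j\ne i}\big)=v_{iA}^\circ$ for all $i\in N$. Let $W(\sigma)=\sum_{j\in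 N}v^\circ_{j\sigma(j)}$ and let $\sigma^*\in P_n$ be a maximizer of $W$. Buyer $i$ receives good $\sigma^*(i)$. (Payment) Let $$P_i(\sigma)=\frac{c_i'}{c_i'-1}W(\sigma)-v^\circ_{i\sigma(i)}+\frac{c_i'}{c_i'-1}\cdot\frac1{c_i'-\sum_{j\ne i}x_{ij}}\sum_{A\in M}x_{ii}^{(A)},$$ where $x_{ij}$ ($j\ne i$) is the common value of $x_{ij}^{(A)}$, $A\in M$ (under the allocation condition these coefficients do not depend on $A$). Buyer $i$ pays $\max_{\sigma\in P_n}P_i(\sigma)-P_i(\sigma^* )$. Truthful bidding: buyer $i$ with signals $s_{iA}$ submits, for each $A$, the function $b_{iA}:\mathbb R^{n-1}\to\mathbb R$ of the form $b_{iA}(v_{-i})=x_{ii}^{(A)}+\sum_{j\ne i}x_{ij}^{(A)}v_j$ with real coefficients such that $b_{iA}\big((v_{jA}(s_A))_{j\ne i}\big)=v_{iA}(s_A)$ for all $s_A\in\mathbb R^n$ whose $i$-th coordinate is the actual $s_{iA}$, the other coordinates being arbitrary (such a function exists and is unique). Nash equilibrium (of pure strategies): at every profile of true signals satisfying the hypotheses, for every buyer $i$, if all other buyers follow their prescribed strategies, then no bid of buyer $i$ gives buyer $i$ a strictly higher utility than the prescribed one. The auction is efficient if there is a Nash equilibrium whose resulting allocation maximizes welfare (at the true signals) among all allocations of the goods to the buyers. *)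

theory Defs
  imports "HOL-Analysis.Analysis"
begin

text \<open>
  Buyers and goods are both indexed by the same finite type \<open>'n\<close>, which plays the role of
  \<open>{1, ..., n}\<close> with \<open>n = CARD('n)\<close>. A signal profile \<open>s\<close> has the signal of buyer \<open>i\<close> for good
  \<open>A\<close> as \<open>s i A\<close>, so the vector of all signals for good \<open>A\<close> is \<open>\<lambda>j. s j A\<close>.
\<close>

type_synonym 'n signals = "'n \<Rightarrow> 'n \<Rightarrow> real"

text \<open>
  The bid of buyer \<open>i\<close> for one good is an affine function of the values of the other buyers. It is
  represented by its coefficients \<open>x\<close>: the constant term is \<open>x i\<close> and the coefficient of the value
  of buyer \<open>j\<close> is \<open>x j\<close>, for \<open>j \<noteq> i\<close>. Distinct coefficient vectors give distinct functions.
  In a bid profile \<open>b\<close>, the coefficient \<open>b i A j\<close> is the number written \<open>x\<^sub>i\<^sub>j\<close> for good \<open>A\<close>.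
\<close>

type_synonym 'n bid = "'n \<Rightarrow> real"
type_synonym 'n bid_profile = "'n \<Rightarrow> 'n \<Rightarrow> 'n bid"

definition bid_fun :: "'n::finite \<Rightarrow> 'n bid \<Rightarrow> ('n \<Rightarrow> real) \<Rightarrow> real" where
  "bid_fun i x v = x i + (\<Sum>j\<in>-{i}. x j * v j)"

definition common_ratio :: "'n::finite bid_profile \<Rightarrow> 'n \<Rightarrow> real \<Rightarrow> bool" where
  "common_ratio b j c \<longleftrightarrow>
     (\<forall>A i. i \<noteq> j \<longrightarrow> 1 / b i A j * (1 - (\<Sum>t\<in>-{i,j}. b i A t)) = c)"

definition goods_allocated :: "'n::finite bid_profile \<Rightarrow> bool" where
  "goods_allocated b \<longleftrightarrow>
     (\<forall>A i j. i \<noteq> j \<longrightarrow> b i A j \<noteq> 0) \<and> (\<forall>j. \<exists>c>1. common_ratio b j c)"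

text \<open>
  The next three descriptions are only used for bid profiles satisfying \<^const>\<open>goods_allocated\<close>.
\<close>

definition ratio :: "'n::finite bid_profile \<Rightarrow> 'n \<Rightarrow> real" where
  "ratio b j = (THE c. c > 1 \<and> common_ratio b j c)"

definition common_coeff :: "'n::finite bid_profile \<Rightarrow> 'n \<Rightarrow> 'n \<Rightarrow> real" where
  "common_coeff b i j = (THE x. \<forall>A. b i A j = x)"

definition fixed_value :: "'n::finite bid_profile \<Rightarrow> 'n \<Rightarrow> 'n \<Rightarrow> real" where
  "fixed_value b A = (THE v. \<forall>i. bid_fun i (b i A) v = v i)"

definition reported_welfare :: "'n::finite bid_profile \<Rightarrow> ('n \<Rightarrow> 'n) \<Rightarrow> real" where
  "reported_welfare b \<sigma> = (\<Sum>j\<in>UNIV. fixed_value b (\<sigma> j) j)"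

text \<open>
  The auction picks some maximizer of the reported welfare; ties may be broken in any way, so the
  auction is parametrized by a rule \<open>\<tau>\<close> that chooses a maximizer for each bid profile.
\<close>

definition maximizer_rule :: "('n::finite bid_profile \<Rightarrow> 'n \<Rightarrow> 'n) \<Rightarrow> bool" where
  "maximizer_rule \<tau> \<longleftrightarrow>
     (\<forall>b. goods_allocated b \<longrightarrow>
        \<tau> b permutes UNIV \<and>
        (\<forall>\<sigma>. \<sigma> permutes UNIV \<longrightarrow> reported_welfare b \<sigma> \<le> reported_welfare b (\<tau> b)))"

definition auction_allocation ::
  "('n::finite bid_profile \<Rightarrow> 'n \<Rightarrow> 'n) \<Rightarrow> 'n bid_profile \<Rightarrow> 'n \<Rightarrow> 'n set" where
  "auction_allocation \<tau> b i = (if goods_allocated b then {\<tau> b i} else {})"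

definition payment_term :: "'n::finite bid_profile \<Rightarrow> 'n \<Rightarrow> ('n \<Rightarrow> 'n) \<Rightarrow> real" where
  "payment_term b i \<sigma> =
     ratio b i / (ratio b i - 1) * reported_welfare b \<sigma>
     - fixed_value b (\<sigma> i) i
     + ratio b i / (ratio b i - 1)
       * (1 / (ratio b i - (\<Sum>j\<in>-{i}. common_coeff b i j)))
       * (\<Sum>A\<in>UNIV. b i A i)"

definition auction_payment ::
  "('n::finite bid_profile \<Rightarrow> 'n \<Rightarrow> 'n) \<Rightarrow> 'n bid_profile \<Rightarrow> 'n \<Rightarrow> real" where
  "auction_payment \<tau> b i =
     (if goods_allocated b
      then Max (payment_term b i ` {\<sigma>. \<sigma> permutes UNIV}) - payment_term b i (\<tau> b)
      else 0)"

text \<open>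
  \<open>V i S s\<close> is the value of the set \<open>S\<close> of goods to buyer \<open>i\<close> at the signal profile \<open>s\<close>.
\<close>

type_synonym 'n set_valuation = "'n \<Rightarrow> 'n set \<Rightarrow> 'n signals \<Rightarrow> real"

definition utility ::
  "('n::finite bid_profile \<Rightarrow> 'n \<Rightarrow> 'n) \<Rightarrow> 'n set_valuation \<Rightarrow> 'n signals \<Rightarrow> 'n bid_profile
    \<Rightarrow> 'n \<Rightarrow> real" where
  "utility \<tau> V s b i = V i (auction_allocation \<tau> b i) s - auction_payment \<tau> b i"

definition welfare :: "'n::finite set_valuation \<Rightarrow> 'n signals \<Rightarrow> ('n \<Rightarrow> 'n set) \<Rightarrow> real" where
  "welfare V s S = (\<Sum>i\<in>UNIV. V i (S i) s)"

text \<open>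
  A strategy of a buyer maps that buyer's own signals (one for each good) to bids (one for each
  good).
\<close>

type_synonym 'n strategy_profile = "'n \<Rightarrow> ('n \<Rightarrow> real) \<Rightarrow> 'n \<Rightarrow> 'n bid"

definition bids_of :: "'n strategy_profile \<Rightarrow> 'n signals \<Rightarrow> 'n bid_profile" where
  "bids_of \<beta> s = (\<lambda>i. \<beta> i (s i))"

text \<open>
  \<open>v j A q\<close> is the value of good \<open>A\<close> to buyer \<open>j\<close> when \<open>q\<close> is the vector of all signals for \<open>A\<close>.
\<close>

definition truthful_strategy :: "('n::finite \<Rightarrow> 'n \<Rightarrow> ('n \<Rightarrow> real) \<Rightarrow> real) \<Rightarrow> 'n strategy_profile" where
  "truthful_strategy v i r A =
     (THE x. \<forall>q. q i = r A \<longrightarrow> bid_fun i x (\<lambda>j. v j A q) = v i A q)"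

text \<open>\<open>\<Theta>\<close> is the set of admissible profiles of true signals.\<close>

definition nash_equilibrium ::
  "('n::finite bid_profile \<Rightarrow> 'n \<Rightarrow> 'n) \<Rightarrow> 'n set_valuation \<Rightarrow> 'n signals set
    \<Rightarrow> 'n strategy_profile \<Rightarrow> bool" where
  "nash_equilibrium \<tau> V \<Theta> \<beta> \<longleftrightarrow>
     (\<forall>s\<in>\<Theta>. \<forall>i x.
        utility \<tau> V s ((bids_of \<beta> s)(i := x)) i \<le> utility \<tau> V s (bids_of \<beta> s) i)"

text \<open>
  The competing allocations are all families of disjoint sets of goods; goods may be left
  unallocated.
\<close>

definition efficient_auction ::
  "('n::finite bid_profile \<Rightarrow> 'n \<Rightarrow> 'n) \<Rightarrow> 'n set_valuation \<Rightarrow> 'n signals set \<Rightarrow> bool" where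
  "efficient_auction \<tau> V \<Theta> \<longleftrightarrow>
     (\<exists>\<beta>. nash_equilibrium \<tau> V \<Theta> \<beta> \<and>
        (\<forall>s\<in>\<Theta>. \<forall>S. disjoint_family S \<longrightarrow>
           welfare V s S \<le> welfare V s (auction_allocation \<tau> (bids_of \<beta> s))))"

end

theory Submission
  imports Defs
begin

text \<open>
  Put \<open>k\<^sub>i = c\<^sub>i - 1\<close> and let \<open>F\<^sub>i\<^sub>A = f\<^sub>i(s\<^sub>i\<^sub>A)\<close>, so that buyer \<open>i\<close> values good \<open>A\<close> at
  \<open>k\<^sub>i F\<^sub>i\<^sub>A + d\<^sub>i + \<Sum>\<^sub>j F\<^sub>j\<^sub>A\<close>. Truthful bids have ratios \<open>c\<^sub>j\<close>, and their fixed point is the vector of true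
  values. Because there are at least three buyers, the bids of the others determine all ratios, and
  the ratios determine the slopes of a bid. Hence a deviating buyer either prevents the allocation
  or bids truthfully for some other signals of his own. In the latter case
  \<open>c\<^sub>i / (c\<^sub>i - 1) W(\<sigma>) - v\<^sub>i\<^sub>\<sigma>\<^sub>(\<^sub>i\<^sub>)\<close> changes only by a constant independent of \<open>\<sigma>\<close>, so his utility is
  \<open>c\<^sub>i / (c\<^sub>i - 1)\<close> times the true welfare of the chosen permutation minus a quantity that he cannot
  influence, and truth-telling makes the auction maximize this welfare.
\<close>

section \<open>Valuations and truthful bids in normalized coordinates\<close>

locale linear_auction =
  fixes k d :: "'n::finite \<Rightarrow> real"
  assumes k_pos: "k i > 0"
begin

definition buyer_value :: "('n \<Rightarrow> real) \<Rightarrow> 'n \<Rightarrow> real" where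
  "buyer_value G i = k i * G i + d i + (\<Sum>j\<in>UNIV. G j)"

definition inv_sum :: "'n \<Rightarrow> real" where
  "inv_sum i = (\<Sum>j\<in>-{i}. 1 / k j)"

definition slope :: "'n \<Rightarrow> 'n \<Rightarrow> real" where
  "slope i j = 1 / k j / (1 + inv_sum i)"

text \<open>Let \<open>u\<close> be the values of the other buyers and \<open>S\<close> the unknown
  sum of \<open>G\<close>. Then \<open>G j = (u j - d j - S) / k j\<close> for
  \<open>j \<noteq> i\<close>; summing and adding \<open>G i = \<phi>\<close> gives \<open>S * (1 +
  inv_sum i) = \<phi> + (\<Sum>j\<in>-{i}. (u j - d j) / k j)\<close>. Substituting this
  \<open>S\<close> into \<open>d i + k i * \<phi> + S\<close> yields the coefficients below.\<close>

definition truthful_bid :: "real \<Rightarrow> 'n \<Rightarrow> 'n bid" where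
  "truthful_bid \<phi> i = (\<lambda>j. if j = i then d i + k i * \<phi> + (\<phi> - (\<Sum>t\<in>-{i}. d t / k t)) / (1 + inv_sum i)
     else slope i j)"

definition truthful_bids :: "('n \<Rightarrow> 'n \<Rightarrow> real) \<Rightarrow> 'n bid_profile" where
  "truthful_bids F = (\<lambda>i A. truthful_bid (F i A) i)"

lemma inv_sum_nonneg: "inv_sum i \<ge> 0"
  unfolding inv_sum_def using k_pos by (intro sum_nonneg) (simp add: less_imp_le)

lemma inv_sum_eq: "inv_sum i = (\<Sum>j\<in>UNIV. 1 / k j) - 1 / k i"
  unfolding inv_sum_def by (simp add: Compl_eq_Diff_UNIV sum_diff1)

lemma slope_pos: "slope i j > 0"
  unfolding slope_def using k_pos[of j] inv_sum_nonneg[of i] by simp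

lemma sum_slope: "(\<Sum>j\<in>-{i}. slope i j) = inv_sum i / (1 + inv_sum i)"
  unfolding slope_def inv_sum_def by (simp add: sum_divide_distrib)

lemma bid_fun_truthful_bid:
  "bid_fun i (truthful_bid \<phi> i) u
     = d i + k i * \<phi> + (\<phi> + (\<Sum>j\<in>-{i}. (u j - d j) / k j)) / (1 + inv_sum i)"
proof -
  have "(\<Sum>j\<in>-{i}. truthful_bid \<phi> i j * u j) = (\<Sum>j\<in>-{i}. u j / k j) / (1 + inv_sum i)"
    unfolding sum_divide_distrib by (rule sum.cong) (auto simp: truthful_bid_def slope_def)
  moreover have "(\<Sum>j\<in>-{i}. (u j - d j) / k j) = (\<Sum>j\<in>-{i}. u j / k j) - (\<Sum>j\<in>-{i}. d j / k j)"
    by (simp add: diff_divide_distrib sum_subtractf)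
  ultimately show ?thesis
    by (simp add: bid_fun_def truthful_bid_def add_divide_distrib diff_divide_distrib)
qed

section \<open>Fixed points of truthful bids\<close>

lemma bid_fun_buyer_value: "bid_fun i (truthful_bid (G i) i) (buyer_value G) = buyer_value G i"
proof -
  let ?S = "\<Sum>j\<in>UNIV. G j"
  have "(\<Sum>j\<in>-{i}. (buyer_value G j - d j) / k j) = (\<Sum>j\<in>-{i}. G j + ?S * (1 / k j))"
    using k_pos by (intro sum.cong) (auto simp: buyer_value_def field_simps less_imp_neq[THEN not_sym])
  also have "\<dots> = ?S - G i + ?S * inv_sum i"
    unfolding inv_sum_def
    by (simp only: sum.distrib sum_distrib_left) (simp add: Compl_eq_Diff_UNIV sum_diff1)
  finally have "G i + (\<Sum>j\<in>-{i}. (buyer_value G j - d j) / k j) = ?S * (1 + inv_sum i)"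
    by (simp add: algebra_simps)
  then show ?thesis
    using inv_sum_nonneg[of i] by (simp add: bid_fun_truthful_bid buyer_value_def)
qed

text \<open>The difference \<open>z\<close> of two fixed points solves a homogeneous system, which
  forces all \<open>z i\<close> to equal one multiple of the weighted sum \<open>T\<close>;
  comparing \<open>T\<close> with itself then gives \<open>T = 0\<close>.\<close>

lemma fixed_point_unique:
  assumes "\<And>i. bid_fun i (truthful_bid (G i) i) u = u i"
  shows "u = buyer_value G"
proof -
  define z where "z i = u i - buyer_value G i" for i
  define T where "T = (\<Sum>j\<in>UNIV. z j / k j)"
  define R where "R = (\<Sum>j\<in>UNIV. 1 / k j)"
  have R: "R \<ge> 0"
    unfolding R_def using k_pos by (intro sum_nonneg) (simp add: less_imp_le)
  have z: "z i * (1 + R) = T" for i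
  proof -
    have "z i = ((\<Sum>j\<in>-{i}. (u j - d j) / k j) - (\<Sum>j\<in>-{i}. (buyer_value G j - d j) / k j)) / (1 + inv_sum i)"
      using assms[of i] bid_fun_buyer_value[of i G]
      by (simp add: z_def bid_fun_truthful_bid add_divide_distrib diff_divide_distrib)
    also have "\<dots> = (\<Sum>j\<in>-{i}. z j / k j) / (1 + inv_sum i)"
      unfolding sum_subtractf[symmetric] diff_divide_distrib[symmetric] by (simp add: z_def)
    finally have "z i * (1 + inv_sum i) = (\<Sum>j\<in>-{i}. z j / k j)"
      using inv_sum_nonneg[of i] by (simp add: field_simps)
    \<comment> \<open>Adding \<open>z i / k i\<close> to both sides completes both sums to all
      buyers, so neither depends on \<open>i\<close> any more.\<close>
    then show ?thesis
      by (simp add: inv_sum_eq T_def R_def Compl_eq_Diff_UNIV sum_diff1 algebra_simps)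
  qed
  have "T * (1 + R) = (\<Sum>j\<in>UNIV. z j * (1 + R) / k j)"
    unfolding T_def by (simp add: sum_distrib_right)
  also have "\<dots> = T * R"
    by (simp only: z) (simp add: R_def sum_distrib_left)
  finally have "T = 0" by (simp add: algebra_simps)
  then have "z i = 0" for i using z[of i] R by simp
  then show ?thesis by (auto simp: z_def fun_eq_iff)
qed

lemma fixed_value_truthful_bids: "fixed_value (truthful_bids F) A = buyer_value (\<lambda>j. F j A)"
  unfolding fixed_value_def truthful_bids_def
  using bid_fun_buyer_value[of _ "\<lambda>j. F j A"] fixed_point_unique[of "\<lambda>j. F j A"]
  by (intro the_equality) blast+

text \<open>The values of the others can be prescribed freely while \<open>G i\<close> stays fixed.
  The witness inverts the valuations, with \<open>S\<close> as the sum that \<open>G\<close> has to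
  have.\<close>

lemma buyer_value_surj:
  obtains G where "G i = \<phi>" "\<And>j. j \<noteq> i \<Longrightarrow> buyer_value G j = u j"
proof -
  define S where "S = (\<phi> + (\<Sum>j\<in>-{i}. (u j - d j) / k j)) / (1 + inv_sum i)"
  define G where "G j = (if j = i then \<phi> else (u j - d j - S) / k j)" for j
  have "(\<Sum>j\<in>UNIV. G j) = \<phi> + (\<Sum>j\<in>-{i}. G j)"
    by (simp add: Compl_eq_Diff_UNIV sum_diff1) (simp add: G_def)
  also have "(\<Sum>j\<in>-{i}. G j) = (\<Sum>j\<in>-{i}. (u j - d j) / k j - S * (1 / k j))"
    by (rule sum.cong) (auto simp: G_def diff_divide_distrib)
  also have "\<dots> = (\<Sum>j\<in>-{i}. (u j - d j) / k j) - S * inv_sum i"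
    unfolding inv_sum_def by (simp only: sum_subtractf sum_distrib_left)
  also have "\<phi> + \<dots> = S"
    using inv_sum_nonneg[of i] by (simp add: S_def field_simps)
  finally have "buyer_value G j = u j" if "j \<noteq> i" for j
    using that k_pos[of j] by (simp add: buyer_value_def) (simp add: G_def)
  moreover have "G i = \<phi>" by (simp add: G_def)
  ultimately show ?thesis using that by blast
qed

text \<open>Since the values of the others are arbitrary, the two affine functions agree everywhere
  and so have equal coefficients.\<close>

lemma truthful_bid_unique:
  assumes "\<And>G. G i = \<phi> \<Longrightarrow> bid_fun i x (buyer_value G) = buyer_value G i"
  shows "x = truthful_bid \<phi> i"
proof -
  let ?y = "truthful_bid \<phi> i"
  have eq: "bid_fun i x u = bid_fun i ?y u" for u
  proof -
    obtain G where G: "G i = \<phi>" "\<And>j. j \<noteq> i \<Longrightarrow> buyer_value G j = u j"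
      using buyer_value_surj[of i \<phi> u] by blast
    have "bid_fun i z u = bid_fun i z (buyer_value G)" for z
      unfolding bid_fun_def using G(2) by (auto intro!: sum.cong)
    then show ?thesis using assms[of G] bid_fun_buyer_value[of i G] G(1) by simp
  qed
  have const: "x i = ?y i" using eq[of "\<lambda>_. 0"] by (simp add: bid_fun_def)
  \<comment> \<open>Evaluating at the \<open>j\<close>-th unit vector isolates the
    \<open>j\<close>-th coefficient.\<close>
  have "x j = ?y j" if "j \<noteq> i" for j
    using eq[of "\<lambda>t. of_bool (t = j)"] const that
    by (simp add: bid_fun_def of_bool_def if_distrib[of "(*) _"] cong: if_cong)
  with const show ?thesis by (metis ext)
qed

section \<open>Ratios and slopes determine each other\<close>

lemma common_ratio_slope:
  assumes "\<And>i A. i \<noteq> j \<Longrightarrow> \<forall>t. t \<noteq> i \<longrightarrow> b i A t = slope i t"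
  shows "common_ratio b j (k j + 1)"
  unfolding common_ratio_def
proof (intro allI impI)
  fix A i assume "i \<noteq> j"
  have "(\<Sum>t\<in>-{i,j}. b i A t) = (\<Sum>t\<in>-{i}-{j}. slope i t)"
    using assms[OF \<open>i \<noteq> j\<close>, of A] by (intro sum.cong) auto
  also have "\<dots> = inv_sum i / (1 + inv_sum i) - slope i j"
    using \<open>i \<noteq> j\<close> by (simp add: sum_diff1 sum_slope)
  finally have "(\<Sum>t\<in>-{i,j}. b i A t) = inv_sum i / (1 + inv_sum i) - slope i j" .
  moreover have frac: "inv_sum i / (1 + inv_sum i) = 1 - 1 / (1 + inv_sum i)"
    using inv_sum_nonneg[of i] by (simp add: field_simps)
  ultimately have "1 - (\<Sum>t\<in>-{i,j}. b i A t) = (1 + 1 / k j) / (1 + inv_sum i)"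
    using frac by (simp add: slope_def add_divide_distrib)
  moreover have "b i A j = 1 / k j / (1 + inv_sum i)"
    using assms[OF \<open>i \<noteq> j\<close>, of A] \<open>i \<noteq> j\<close> by (simp add: slope_def)
  moreover have "1 / (1 / k / h) * ((1 + 1 / k) / h) = k + 1" if "k > 0" "h > 0" for k h :: real
    using that by (simp add: field_simps)
  ultimately show "1 / b i A j * (1 - (\<Sum>t\<in>-{i,j}. b i A t)) = k j + 1"
    using inv_sum_nonneg[of i] k_pos[of j] by simp
qed

lemma common_ratio_truthful_bids: "common_ratio (truthful_bids F) j (k j + 1)"
  by (rule common_ratio_slope) (simp add: truthful_bids_def truthful_bid_def)

lemma goods_allocated_truthful_bids: "goods_allocated (truthful_bids F)"
  unfolding goods_allocated_def
proof (intro conjI allI impI)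
  show "truthful_bids F i A j \<noteq> 0" if "i \<noteq> j" for A i j
    using that slope_pos[of i j] by (simp add: truthful_bids_def truthful_bid_def)
  show "\<exists>c>1. common_ratio (truthful_bids F) j c" for j
    using common_ratio_truthful_bids k_pos[of j] by (intro exI[of _ "k j + 1"]) simp
qed

text \<open>With \<rho> equal to 1 minus the sum of all slopes of buyer \<open>i\<close>, the ratio
  equation for \<open>j\<close> becomes \<open>\<rho> = k j * b i A j\<close>. The slopes are thus
  proportional to \<open>1 / k j\<close>, and summing them determines \<rho>.\<close>

lemma slope_of_common_ratio:
  assumes nz: "\<And>j. j \<noteq> i \<Longrightarrow> b i A j \<noteq> 0"
    and ratio: "\<And>j. j \<noteq> i \<Longrightarrow> common_ratio b j (k j + 1)"
    and "j \<noteq> i"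
  shows "b i A j = slope i j"
proof -
  define \<rho> where "\<rho> = 1 - (\<Sum>t\<in>-{i}. b i A t)"
  have b: "b i A j = \<rho> * (1 / k j)" if "j \<noteq> i" for j
  proof -
    have "1 / b i A j * (1 - (\<Sum>t\<in>-{i,j}. b i A t)) = k j + 1"
      using ratio[OF that] that unfolding common_ratio_def by auto
    then have "1 - (\<Sum>t\<in>-{i,j}. b i A t) = (k j + 1) * b i A j"
      using nz[OF that] by (simp add: field_simps)
    moreover have "-{i,j} = -{i}-{j}" by auto
    ultimately have "\<rho> = k j * b i A j"
      using that by (simp add: \<rho>_def sum_diff1 algebra_simps)
    then show ?thesis using k_pos[of j] by simp
  qed
  have "\<rho> = 1 - \<rho> * inv_sum i"
    unfolding inv_sum_def sum_distrib_left by (subst \<rho>_def) (simp add: b)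
  then have "\<rho> = 1 / (1 + inv_sum i)"
    using inv_sum_nonneg[of i] by (simp add: field_simps)
  then show ?thesis using b[OF \<open>j \<noteq> i\<close>] by (simp add: slope_def)
qed

text \<open>The constant term of a truthful bid is affine in \<phi> with positive slope
  \<open>k i + 1 / (1 + inv_sum i)\<close>, so it takes every real value.\<close>

lemma truthful_bid_surj:
  assumes "\<And>j. j \<noteq> i \<Longrightarrow> x j = slope i j"
  obtains \<phi> where "x = truthful_bid \<phi> i"
proof -
  let ?h = "1 + inv_sum i"
  define C where "C = d i - (\<Sum>t\<in>-{i}. d t / k t) / ?h"
  define \<phi> where "\<phi> = (x i - C) / (k i + 1 / ?h)"
  have "k i + 1 / ?h > 0"
    using k_pos[of i] inv_sum_nonneg[of i] by (intro add_pos_nonneg) auto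
  then have "(k i + 1 / ?h) * \<phi> = x i - C" by (simp add: \<phi>_def)
  then have "x i = truthful_bid \<phi> i i"
    by (simp add: truthful_bid_def C_def algebra_simps diff_divide_distrib)
  then have "x = truthful_bid \<phi> i"
    using assms by (auto simp: fun_eq_iff truthful_bid_def)
  then show ?thesis using that by blast
qed

end

lemma common_ratio_unique:
  assumes "common_ratio b j c" "common_ratio b j c'" "i \<noteq> j"
  shows "c = c'"
  using assms unfolding common_ratio_def by metis

lemma exists_third:
  fixes i j :: "'n::finite"
  assumes "CARD('n) \<ge> 3"
  shows "\<exists>t. t \<noteq> i \<and> t \<noteq> j"
proof (rule ccontr)
  assume "\<not> ?thesis"
  then have "UNIV = {i, j}" by auto
  then have "CARD('n) = card {i, j}" by simp
  also have "\<dots> \<le> 2" by (simp add: card_insert_if)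
  finally show False using assms by simp
qed

lemma ex_permutes: "{\<sigma>. \<sigma> permutes UNIV} \<noteq> {}"
  using permutes_id by blast

section \<open>Deviations, payments and utilities\<close>

context linear_auction
begin

definition true_welfare :: "('n \<Rightarrow> 'n \<Rightarrow> real) \<Rightarrow> ('n \<Rightarrow> 'n) \<Rightarrow> real" where
  "true_welfare F \<sigma> = (\<Sum>j\<in>UNIV. buyer_value (\<lambda>t. F t (\<sigma> j)) j)"

text \<open>This is the part of \<open>payment_term\<close> that depends on \<sigma>; the rest
  cancels in the payment.\<close>

definition score :: "('n \<Rightarrow> 'n \<Rightarrow> real) \<Rightarrow> 'n \<Rightarrow> ('n \<Rightarrow> 'n) \<Rightarrow> real" where
  "score F i \<sigma> = (k i + 1) / k i * true_welfare F \<sigma> - buyer_value (\<lambda>t. F t (\<sigma> i)) i"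

lemma reported_welfare_truthful_bids: "reported_welfare (truthful_bids F) \<sigma> = true_welfare F \<sigma>"
  by (simp add: reported_welfare_def true_welfare_def fixed_value_truthful_bids)

lemma deviation_truthful:
  assumes card: "CARD('n) \<ge> 3"
    and alloc: "goods_allocated ((truthful_bids F)(i := x))"
  obtains \<phi> where "(truthful_bids F)(i := x) = truthful_bids (F(i := \<phi>))"
proof -
  let ?b = "(truthful_bids F)(i := x)"
  have ratio: "common_ratio ?b j (k j + 1)" for j
  proof -
    obtain c where c: "common_ratio ?b j c"
      using alloc unfolding goods_allocated_def by blast
    \<comment> \<open>The bid of \<open>t\<close> is untouched by the deviation and occurs in the
      ratio equation of \<open>j\<close>, hence fixes the ratio, even for
      \<open>j = i\<close>.\<close>
    obtain t where t: "t \<noteq> i" "t \<noteq> j" using exists_third[OF card] by blast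
    have "?b t A = truthful_bids F t A" for A using t by simp
    then have "c = k j + 1"
      using c common_ratio_truthful_bids[of F j] t unfolding common_ratio_def by metis
    with c show ?thesis by simp
  qed
  have "x A j = slope i j" if "j \<noteq> i" for A j
  proof -
    have "?b i A t \<noteq> 0" if "t \<noteq> i" for t
      using alloc that unfolding goods_allocated_def by metis
    then have "?b i A j = slope i j"
      using slope_of_common_ratio[of i ?b A j] ratio that by blast
    then show ?thesis by simp
  qed
  then have "\<exists>\<psi>. x A = truthful_bid \<psi> i" for A
    using truthful_bid_surj[of i "x A"] by metis
  then obtain \<phi> where "\<And>A. x A = truthful_bid (\<phi> A) i" by metis
  then have "?b = truthful_bids (F(i := \<phi>))"
    by (auto simp: truthful_bids_def fun_eq_iff)
  then show ?thesis using that by blast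
qed

lemma payment_term_truthful_bids:
  assumes "CARD('n) \<ge> 3"
  shows "\<exists>C. \<forall>\<sigma>. payment_term (truthful_bids F) i \<sigma> = score F i \<sigma> + C"
proof -
  obtain t where "t \<noteq> i" using exists_third[OF assms] by blast
  then have "ratio (truthful_bids F) i = k i + 1"
    unfolding ratio_def using common_ratio_truthful_bids[of F i] k_pos[of i]
    by (intro the_equality) (auto dest: common_ratio_unique)
  then show ?thesis
    by (auto simp: payment_term_def score_def reported_welfare_truthful_bids
        fixed_value_truthful_bids)
qed

lemma auction_payment_truthful_bids:
  assumes "CARD('n) \<ge> 3"
  shows "auction_payment \<tau> (truthful_bids F) i
    = Max (score F i ` {\<sigma>. \<sigma> permutes UNIV}) - score F i (\<tau> (truthful_bids F))"
proof -
  obtain C where C: "\<And>\<sigma>. payment_term (truthful_bids F) i \<sigma> = score F i \<sigma> + C"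
    using payment_term_truthful_bids[OF assms] by blast
  then have "payment_term (truthful_bids F) i = (\<lambda>\<sigma>. score F i \<sigma> + C)" by auto
  then show ?thesis
    using Max_add_commute[OF finite_permutations ex_permutes, of "score F i" C]
    by (simp add: auction_payment_def goods_allocated_truthful_bids)
qed

text \<open>Under a permutation every good is sold once, so the common parts of the values add up to
  a total over all goods that is independent of \<sigma>. Buyer \<open>i\<close> then influences the
  dependence on \<sigma> only through \<open>k i * F i (\<sigma> i)\<close>.\<close>

lemma true_welfare_split:
  assumes "\<sigma> permutes UNIV"
  shows "true_welfare F \<sigma> = k i * F i (\<sigma> i) + (\<Sum>A\<in>UNIV. F i A)
    + ((\<Sum>j\<in>-{i}. k j * F j (\<sigma> j)) + (\<Sum>j\<in>UNIV. d j) + (\<Sum>j\<in>-{i}. \<Sum>A\<in>UNIV. F j A))"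
proof -
  have "true_welfare F \<sigma> = (\<Sum>j\<in>UNIV. k j * F j (\<sigma> j)) + (\<Sum>j\<in>UNIV. d j)
      + (\<Sum>j\<in>UNIV. \<Sum>t\<in>UNIV. F t (\<sigma> j))"
    by (simp add: true_welfare_def buyer_value_def sum.distrib)
  also have "(\<Sum>j\<in>UNIV. \<Sum>t\<in>UNIV. F t (\<sigma> j)) = (\<Sum>A\<in>UNIV. \<Sum>t\<in>UNIV. F t A)"
    using sum.permute[OF assms, of "\<lambda>A. \<Sum>t\<in>UNIV. F t A"] by (simp add: o_def)
  also have "\<dots> = (\<Sum>t\<in>UNIV. \<Sum>A\<in>UNIV. F t A)" by (rule sum.swap)
  finally show ?thesis
    by (simp add: Compl_eq_Diff_UNIV sum_diff1)
qed

text \<open>The factor \<open>(k i + 1) / k i\<close> turns \<open>k i * F i (\<sigma> i)\<close>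
  into \<open>(k i + 1) * F i (\<sigma> i)\<close>, exactly the weight of
  \<open>F i (\<sigma> i)\<close> in the subtracted value of buyer \<open>i\<close>. The two cancel,
  leaving only the sum of \<open>F i\<close> over all goods.\<close>

lemma score_change:
  "\<exists>C. \<forall>\<sigma>. \<sigma> permutes UNIV \<longrightarrow> score (F(i := \<phi>)) i \<sigma> = score F i \<sigma> + C"
proof -
  \<comment> \<open>\<open>R\<close> collects what does not involve the row
    \<open>F i\<close>.\<close>
  define R where "R \<sigma> = (\<Sum>j\<in>-{i}. k j * F j (\<sigma> j)) + (\<Sum>j\<in>UNIV. d j)
    + (\<Sum>j\<in>-{i}. \<Sum>A\<in>UNIV. F j A)" for \<sigma>
  have score: "score (F(i := \<psi>)) i \<sigma> = (k i + 1) / k i * ((\<Sum>A\<in>UNIV. \<psi> A) + R \<sigma>)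
      - d i - (\<Sum>j\<in>-{i}. F j (\<sigma> i))" if "\<sigma> permutes UNIV" for \<psi> \<sigma>
  proof -
    have "(\<Sum>j\<in>UNIV. (F(i := \<psi>)) j (\<sigma> i)) = \<psi> (\<sigma> i) + (\<Sum>j\<in>-{i}. F j (\<sigma> i))"
      by (subst sum.remove[of _ i]) (auto simp: Compl_eq_Diff_UNIV intro!: sum.cong)
    then show ?thesis
      using k_pos[of i]
      by (simp add: score_def true_welfare_split[OF that, of _ i] buyer_value_def R_def field_simps)
  qed
  have "score (F(i := \<phi>)) i \<sigma> = score F i \<sigma> + (k i + 1) / k i * ((\<Sum>A\<in>UNIV. \<phi> A) - (\<Sum>A\<in>UNIV. F i A))"
    if "\<sigma> permutes UNIV" for \<sigma>
    using score[OF that, of \<phi>] score[OF that, of "F i"] by (simp only: algebra_simps) simp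
  then show ?thesis by blast
qed

text \<open>The reported row \<phi> shifts the maximal score and the chosen score equally, so the
  payment can be computed with the true \<open>F\<close>. The true value of the received good then
  cancels the one in \<open>score\<close>, and \<phi> matters only through the chosen
  permutation.\<close>

lemma deviation_utility:
  fixes F :: "'n \<Rightarrow> 'n \<Rightarrow> real" and i :: 'n and \<phi> :: "'n \<Rightarrow> real"
  assumes card: "CARD('n) \<ge> 3" and \<tau>: "maximizer_rule \<tau>"
  defines "b \<equiv> truthful_bids (F(i := \<phi>))"
  shows "buyer_value (\<lambda>t. F t (\<tau> b i)) i - auction_payment \<tau> b i
    = (k i + 1) / k i * true_welfare F (\<tau> b) - Max (score F i ` {\<sigma>. \<sigma> permutes UNIV})"
proof -
  let ?P = "{\<sigma>. \<sigma> permutes (UNIV :: 'n set)}"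
  obtain C where C: "\<And>\<sigma>. \<sigma> \<in> ?P \<Longrightarrow> score (F(i := \<phi>)) i \<sigma> = score F i \<sigma> + C"
    using score_change[of F i \<phi>] by blast
  have "\<tau> b \<in> ?P"
    using \<tau> goods_allocated_truthful_bids unfolding maximizer_rule_def b_def by blast
  moreover have "Max (score (F(i := \<phi>)) i ` ?P) = Max (score F i ` ?P) + C"
    using C Max_add_commute[OF finite_permutations ex_permutes, of "score F i" C]
    by (simp cong: image_cong_simp)
  ultimately have "auction_payment \<tau> b i = Max (score F i ` ?P) - score F i (\<tau> b)"
    unfolding b_def using C auction_payment_truthful_bids[OF card] by simp
  then show ?thesis by (simp add: score_def)
qed

lemma truthful_maximizes:
  assumes "maximizer_rule \<tau>" "\<sigma> permutes UNIV"
  shows "true_welfare F \<sigma> \<le> true_welfare F (\<tau> (truthful_bids F))"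
  using assms goods_allocated_truthful_bids[of F]
  unfolding maximizer_rule_def reported_welfare_truthful_bids[symmetric] by blast

text \<open>The two claims cover the two kinds of deviation: truthful bids for other signals, and
  bids that block the allocation and yield utility 0.\<close>

lemma truthful_utility_ge:
  fixes F :: "'n \<Rightarrow> 'n \<Rightarrow> real" and i :: 'n
  assumes card: "CARD('n) \<ge> 3" and \<tau>: "maximizer_rule \<tau>"
  defines "b \<equiv> truthful_bids F"
  defines "u \<equiv> buyer_value (\<lambda>t. F t (\<tau> b i)) i - auction_payment \<tau> b i"
  shows "buyer_value (\<lambda>t. F t (\<tau> (truthful_bids (F(i := \<phi>))) i)) i
      - auction_payment \<tau> (truthful_bids (F(i := \<phi>))) i \<le> u"
    and "(\<And>A. buyer_value (\<lambda>t. F t A) i \<ge> 0) \<Longrightarrow> u \<ge> 0"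
proof -
  let ?P = "{\<sigma>. \<sigma> permutes (UNIV :: 'n set)}"
  have pos: "(k i + 1) / k i \<ge> 0" using k_pos[of i] by simp
  have u: "u = (k i + 1) / k i * true_welfare F (\<tau> b) - Max (score F i ` ?P)"
    \<comment> \<open>Truth-telling is the deviation to the row \<open>F i\<close> itself.\<close>
    using deviation_utility[OF card \<tau>, of F i "F i"] by (simp add: u_def b_def)
  have perm: "\<tau> (truthful_bids (F(i := \<phi>))) permutes UNIV"
    using \<tau> goods_allocated_truthful_bids unfolding maximizer_rule_def by blast
  show "buyer_value (\<lambda>t. F t (\<tau> (truthful_bids (F(i := \<phi>))) i)) i
      - auction_payment \<tau> (truthful_bids (F(i := \<phi>))) i \<le> u"
    unfolding u deviation_utility[OF card \<tau>] b_def
    using mult_left_mono[OF truthful_maximizes[OF \<tau> perm, of F] pos] by simp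
  show "u \<ge> 0" if nonneg: "\<And>A. buyer_value (\<lambda>t. F t A) i \<ge> 0"
  proof -
    have "score F i \<sigma> \<le> (k i + 1) / k i * true_welfare F (\<tau> b)" if "\<sigma> \<in> ?P" for \<sigma>
      using mult_left_mono[OF truthful_maximizes[OF \<tau>, of \<sigma> F] pos] nonneg[of "\<sigma> i"] that
      unfolding score_def b_def by auto
    then have "Max (score F i ` ?P) \<le> (k i + 1) / k i * true_welfare F (\<tau> b)"
      using finite_permutations[of "UNIV :: 'n set"] ex_permutes by (subst Max_le_iff) auto
    then show ?thesis unfolding u by simp
  qed
qed

end

section \<open>Reducing arbitrary allocations to permutations\<close>

lemma inj_on_extend_permutes:
  fixes g :: "'n::finite \<Rightarrow> 'n"
  assumes "inj_on g A"
  shows "\<exists>\<sigma>. \<sigma> permutes UNIV \<and> (\<forall>i\<in>A. \<sigma> i = g i)"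
proof -
  have "card (- A) = card (- g ` A)"
    using assms by (simp add: Compl_eq_Diff_UNIV card_Diff_subset card_image)
  then obtain h where h: "bij_betw h (- A) (- g ` A)"
    using finite_same_card_bij[of "- A" "- g ` A"] by auto
  define \<sigma> where "\<sigma> i = (if i \<in> A then g i else h i)" for i
  have "bij_betw \<sigma> (A \<union> - A) (g ` A \<union> - g ` A)"
    unfolding \<sigma>_def using assms h
    by (intro bij_betw_disjoint_Un) (auto simp: bij_betw_def)
  then have "\<sigma> permutes UNIV"
    by (intro bij_imp_permutes) simp_all
  then show ?thesis by (auto simp: \<sigma>_def)
qed

text \<open>Each buyer with a nonempty set keeps only a best good of it, which loses nothing.
  Disjointness makes this choice injective; extending it to a permutation gives the remaining buyers
  goods of nonnegative value.\<close>

lemma welfare_le_permutation: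
  fixes V :: "'n::finite set_valuation"
  assumes empty: "\<And>i. V i {} s = 0"
    and max: "\<And>i S. S \<noteq> {} \<Longrightarrow> V i S s = Max (u i ` S)"
    and nonneg: "\<And>i K. u i K \<ge> 0"
    and disj: "disjoint_family S"
  obtains \<sigma> where "\<sigma> permutes UNIV" "welfare V s S \<le> (\<Sum>i\<in>UNIV. u i (\<sigma> i))"
proof -
  have "\<exists>K. S i \<noteq> {} \<longrightarrow> K \<in> S i \<and> V i (S i) s = u i K" for i
  proof (cases "S i = {}")
    case False
    then have "Max (u i ` S i) \<in> u i ` S i" by (intro Max_in) auto
    then show ?thesis using max[OF False] by auto
  qed simp
  then obtain g where g: "\<And>i. S i \<noteq> {} \<Longrightarrow> g i \<in> S i \<and> V i (S i) s = u i (g i)"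
    by metis
  have inj: "inj_on g {i. S i \<noteq> {}}"
  proof (rule inj_onI)
    fix i j assume ij: "i \<in> {i. S i \<noteq> {}}" "j \<in> {i. S i \<noteq> {}}" "g i = g j"
    then have "g i \<in> S i \<inter> S j" using g[of i] g[of j] by simp
    then show "i = j" using disj unfolding disjoint_family_on_def by blast
  qed
  obtain \<sigma> where \<sigma>: "\<sigma> permutes UNIV" "\<forall>i\<in>{i. S i \<noteq> {}}. \<sigma> i = g i"
    using inj_on_extend_permutes[OF inj] by blast
  have "V i (S i) s \<le> u i (\<sigma> i)" for i
    using g[of i] \<sigma>(2) empty nonneg by (cases "S i = {}") auto
  then have "welfare V s S \<le> (\<Sum>i\<in>UNIV. u i (\<sigma> i))"
    unfolding welfare_def by (intro sum_mono)
  with \<sigma>(1) show ?thesis using that by blast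
qed

section \<open>Return to signals and set valuations\<close>

theorem theorem5p4:
  fixes w f :: "'n::finite \<Rightarrow> real \<Rightarrow> real"
    and v :: "'n \<Rightarrow> 'n \<Rightarrow> ('n \<Rightarrow> real) \<Rightarrow> real"
    and V :: "'n set_valuation"
    and \<tau> :: "'n bid_profile \<Rightarrow> 'n \<Rightarrow> 'n"
    and \<Theta> :: "'n signals set"
  assumes "CARD('n) \<ge> 3"
    and "\<And>i. \<exists>a b. \<forall>x. w i x = a * x + b"
    and "\<And>i. \<exists>a b. \<forall>x. f i x = a * x + b"
    and "\<And>i. strict_mono (w i)"
    and "\<And>i s. V i {} s = 0"
    and "\<And>i S s. S \<noteq> {} \<Longrightarrow> V i S s = Max ((\<lambda>K. v i K (\<lambda>j. s j K)) ` S)"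
    and "\<And>i K q. v i K q = w i (q i) + (\<Sum>j\<in>-{i}. f j (q j))"
    and "\<And>i x. deriv (w i) x > deriv (f i) x"
    and "\<Theta> = {s. \<forall>i S. V i S s \<ge> 0}"
    and "\<And>i. \<exists>c d. c > 1 \<and> (\<forall>x. w i x = c * f i x + d)"
    and "\<And>i. inj (f i) \<and> range (f i) = UNIV"
    and "maximizer_rule \<tau>"
  shows "nash_equilibrium \<tau> V \<Theta> (truthful_strategy v) \<and> efficient_auction \<tau> V \<Theta>"
proof -
  obtain c d where cd: "\<And>i. c i > 1" "\<And>i x. w i x = c i * f i x + d i"
    using assms(10) by metis
  \<comment> \<open>One copy of \<open>f i\<close> goes into the sum over all buyers, which leaves
    \<open>c i - 1\<close>.\<close>
  define k where "k i = c i - 1" for i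
  interpret linear_auction k d
    by unfold_locales (use cd(1) in \<open>simp add: k_def\<close>)
  note card = assms(1) and \<tau> = assms(12)
  have v: "v i K q = buyer_value (\<lambda>j. f j (q j)) i" for i K q
  proof -
    have "(\<Sum>j\<in>-{i}. f j (q j)) = (\<Sum>j\<in>UNIV. f j (q j)) - f i (q i)"
      by (simp add: Compl_eq_Diff_UNIV sum_diff1)
    then show ?thesis
      unfolding assms(7) buyer_value_def by (simp add: cd(2) k_def algebra_simps)
  qed
  have strategy: "truthful_strategy v i r A = truthful_bid (f i (r A)) i" for i r A
    unfolding truthful_strategy_def
  proof (rule the_equality)
    show "\<forall>q. q i = r A \<longrightarrow> bid_fun i (truthful_bid (f i (r A)) i) (\<lambda>j. v j A q) = v i A q"
    proof (intro allI impI)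
      fix q assume "q i = r A"
      then show "bid_fun i (truthful_bid (f i (r A)) i) (\<lambda>j. v j A q) = v i A q"
        using bid_fun_buyer_value[of i "\<lambda>j. f j (q j)"] by (simp add: v)
    qed
  next
    fix x assume x: "\<forall>q. q i = r A \<longrightarrow> bid_fun i x (\<lambda>j. v j A q) = v i A q"
    show "x = truthful_bid (f i (r A)) i"
    proof (rule truthful_bid_unique)
      fix G assume G: "G i = f i (r A)"
      \<comment> \<open>Surjectivity of each \<open>f j\<close> realizes an arbitrary
        \<open>G\<close> by signals; injectivity of \<open>f i\<close> then makes the own signal the
        actual one.\<close>
      define q where "q j = inv (f j) (G j)" for j
      have q: "f j (q j) = G j" for j
        using assms(11)[of j] by (simp add: q_def surj_f_inv_f)
      have "q i = r A" using q[of i] G assms(11)[of i] by (auto dest: injD)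
      with x have "bid_fun i x (\<lambda>j. v j A q) = v i A q" by blast
      then show "bid_fun i x (buyer_value G) = buyer_value G i" by (simp add: v q)
    qed
  qed
  define F where "F s j A = f j (s j A)" for s :: "'n signals" and j A
  have bids: "bids_of (truthful_strategy v) s = truthful_bids (F s)" for s
    by (simp add: bids_of_def truthful_bids_def strategy F_def fun_eq_iff)
  have V_single: "V i {K} s = buyer_value (\<lambda>t. F s t K) i" for i K s
    by (simp add: assms(6) v F_def)
  \<comment> \<open>Nonnegativity of all set values is applied to singletons.\<close>
  have nonneg: "buyer_value (\<lambda>t. F s t K) i \<ge> 0" if "s \<in> \<Theta>" for s i K
    using that unfolding assms(9) V_single[symmetric] by blast
  have nash: "nash_equilibrium \<tau> V \<Theta> (truthful_strategy v)"
    unfolding nash_equilibrium_def bids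
  proof (intro ballI allI)
    fix s i x assume s: "s \<in> \<Theta>"
    let ?b = "(truthful_bids (F s))(i := x)"
    have truthful: "utility \<tau> V s (truthful_bids (F s)) i
        = buyer_value (\<lambda>t. F s t (\<tau> (truthful_bids (F s)) i)) i - auction_payment \<tau> (truthful_bids (F s)) i"
      by (simp add: utility_def auction_allocation_def goods_allocated_truthful_bids V_single)
    show "utility \<tau> V s ?b i \<le> utility \<tau> V s (truthful_bids (F s)) i"
    proof (cases "goods_allocated ?b")
      case True
      then obtain \<phi> where "?b = truthful_bids ((F s)(i := \<phi>))"
        using deviation_truthful[OF card] by blast
      then show ?thesis
        using truthful_utility_ge(1)[OF card \<tau>, of "F s" i \<phi>] unfolding truthful
        by (simp add: utility_def auction_allocation_def goods_allocated_truthful_bids V_single)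
    next
      case False
      then have "utility \<tau> V s ?b i = 0"
        by (simp add: utility_def auction_allocation_def auction_payment_def assms(5))
      then show ?thesis
        using truthful_utility_ge(2)[OF card \<tau>, of "F s" i] nonneg[OF s] unfolding truthful by simp
    qed
  qed
  have "welfare V s S \<le> welfare V s (auction_allocation \<tau> (bids_of (truthful_strategy v) s))"
    if s: "s \<in> \<Theta>" and S: "disjoint_family S" for s S
  proof -
    obtain \<sigma> where \<sigma>: "\<sigma> permutes UNIV"
      "welfare V s S \<le> (\<Sum>i\<in>UNIV. buyer_value (\<lambda>t. F s t (\<sigma> i)) i)"
      using welfare_le_permutation[of V s "\<lambda>i K. buyer_value (\<lambda>t. F s t K) i" S] S nonneg[OF s]
        assms(5,6) by (auto simp: v F_def)
    have "welfare V s (auction_allocation \<tau> (bids_of (truthful_strategy v) s))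
        = true_welfare (F s) (\<tau> (truthful_bids (F s)))"
      by (simp add: welfare_def bids auction_allocation_def goods_allocated_truthful_bids
          V_single true_welfare_def)
    then show ?thesis
      using \<sigma>(2) truthful_maximizes[OF \<tau> \<sigma>(1), of "F s"] by (simp add: true_welfare_def)
  qed
  with nash show ?thesis unfolding efficient_auction_def by blast
qed

end
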